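(* Let $X$ and $Y$ be real locally convex topological vector spaces in duality through a bilinear product $\langle\cdot,\cdot\rangle : X\times Y\to\mathbb{R}$, with topologies compatible with the duality. Let $M\subset X\times Y$ be a BB-graph, let $\lambda\in\Lambda\mapsto\phi_\lambda$ be a BIC-cover of $M$, and define $b:X\times Y\to\mathbb{R}\cup\{+\infty\}$ by $$b(x,y)=\inf\{\phi_\lambda(x)+\phi_\lambda^*(y) : \lambda\in\Lambda\}.$$ Then $b$ is a bipotential and $M=M(b)$.
   Context: Setting: $X,Y$ are real locally convex topological vector spaces with a bilinear duality product $\langle\cdot,\cdot\rangle:X\times Y\to\mathbb{R}$. The topologies are compatible with the duality: the continuous linear functionals on $X$ are exactly the maps $x\mapsto\langle x,y\rangle$, $y\in Y$, and the continuous linear functionals on $Y$ are exactly the maps $y\mapsto\langle x,y\rangle$, $x\in X$. Write $\bar{\mathbb{R}}=\mathbb{R}\cup\{+\infty\}$. Convex analysis: $\Gamma(X)$ is the class of convex lower semicontinuous functions $\phi:X\to\bar{\mathbb{R}}$, not identically $+\infty$. The polar of $\phi$ is $\phi^*:Y\to\bar{\mathbb{R}}$, $\phi^*(y)=\sup\{\langle x,y\rangle-\phi(x):x\in X\}$. For $\phi\in\Gamma(X)$, $M(\phi)=\{(x,y)\in X\times Y:\phi(x)+\phi^*(y)=\langle x,y\rangle\}$. For a function $\phi:X\to\bar{\mathbb{R}}$ and $x\in X$ with $\phi(x)<+\infty$, $\partial\phi(x)=\{u\in Y:\langle z-x,u\rangle\le\phi(z)-\phi(x)\ \ \forall z\in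 X\}$; if $\phi(x)=+\infty$, then $\partial\phi(x)=\emptyset$. Subgradients of functions on $Y$ are defined in the same way and are subsets of $X$. Bipotential: a function $b:X\times Y\to\bar{\mathbb{R}}$ such that (a) $b$ is convex and lower semicontinuous in each argument separately; (b) $b(x,y)\ge\langle x,y\rangle$ for all $(x,y)$; (c) for all $(x,y)\in X\times Y$: $y\in\partial b(\cdot,y)(x)\iff x\in\partial b(x,\cdot)(y)\iff b(x,y)=\langle x,y\rangle$. Its graph is $M(b)=\{(x,y)\in X\times Y:b(x,y)=\langle x,y\rangle\}$. BB-graph: a non-empty set $M\subset X\times Y$ such that every non-empty section $m(x)=\{y\in Y:(x,y)\in M\}$, $x\in X$, and every non-empty section $m^*(y)=\{x\in X:(x,y)\in M\}$, $y\in Y$, is convex and closed. Convex lagrangian cover of a non-empty set $M\subset X\times Y$: a map $\lambda\in\Lambda\mapsto\phi_\lambda\in\Gamma(X)$ such that (a) $\Lambda$ is a non-empty compact topological space; (b) with $f:\Lambda\times X\times Y\to\bar{\mathbb{R}}$, $f(\lambda,x,y)=\phi_\lambda(x)+\phi_\lambda^*(y)$, for every $x\in X$ and every $y\in Y$ the functions $f(\cdot,x,\cdot):\Lambda\times Y\to\bar{\mathbb{R}}$ and $f(\cdot,\cdot,y):\Lambda\times X\to\bar{\mathbb{R}}$ are lower semicontinuous for the product topologies; (c) $M=\bigcup_{\lambda\in\Lambda}M(\phi_\lambda)$. Implicit convexity: for a non-empty set $\Lambda$ and a real vector space $V$, a function $g:\Lambda\times V\to\bar{\mathbb{R}}$ is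 implicitly convex if for all $(\lambda_1,z_1),(\lambda_2,z_2)\in\Lambda\times V$ and all $\alpha,\beta\in[0,1]$ with $\alpha+\beta=1$ there exists $\lambda\in\Lambda$ such that $g(\lambda,\alpha z_1+\beta z_2)\le\alpha g(\lambda_1,z_1)+\beta g(\lambda_2,z_2)$ (with $0\cdot(+\infty)=0$). BIC-cover (bi-implicitly convex cover) of $M$: a convex lagrangian cover of $M$ such that, with $f$ as in (b), for every $y\in Y$ and every $x\in X$ the functions $f(\cdot,\cdot,y)$ and $f(\cdot,x,\cdot)$ are implicitly convex. *)

theory Defs
  imports "HOL-Analysis.Analysis"
begin

text \<open>
  Functions with values in the reals extended by plus infinity are functions into \<^typ>\<open>ereal\<close>
  that do not attain \<^term>\<open>- \<infinity> :: ereal\<close>. With this proviso the library's arithmetic agrees with the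
  conventions of convex analysis; in particular \<open>0 * \<infinity> = 0\<close>.
\<close>

text \<open>Real locally convex topological vector spaces; the Hausdorff property is not part of the class.
  Convexity is unfolded in the last axiom because \<^const>\<open>convex\<close> carries the sort constraint
  \<^class>\<open>real_vector\<close> and so cannot occur in a class specification.\<close>

class real_lctvs = real_vector + topological_ab_group_add +
  assumes tendsto_scaleR_lctvs:
    "((\<lambda>p. fst p *\<^sub>R snd p) \<longlongrightarrow> r *\<^sub>R a) (nhds r \<times>\<^sub>F nhds a)"
  assumes locally_convex_unfolded:
    "open U \<Longrightarrow> a \<in> U \<Longrightarrow>
      \<exists>C V. (\<forall>x\<in>C. \<forall>y\<in>C. \<forall>u\<ge>0. \<forall>v\<ge>0. u + v = 1 \<longrightarrow> u *\<^sub>R x + v *\<^sub>R y \<in> C) \<and>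
        open V \<and> a \<in> V \<and> V \<subseteq> C \<and> C \<subseteq> U"

lemma locally_convex:
  fixes a :: "'a::real_lctvs"
  assumes "open U" "a \<in> U"
  shows "\<exists>C V. convex C \<and> open V \<and> a \<in> V \<and> V \<subseteq> C \<and> C \<subseteq> U"
  using locally_convex_unfolded[OF assms] unfolding convex_def .

text \<open>The duality product is not assumed to separate points.\<close>

definition compatible_duality :: "('a::real_lctvs \<Rightarrow> 'b::real_lctvs \<Rightarrow> real) \<Rightarrow> bool" where
  "compatible_duality B \<longleftrightarrow> bilinear B \<and>
     {l. linear l \<and> continuous_on UNIV l} = range (\<lambda>y x. B x y) \<and>
     {l. linear l \<and> continuous_on UNIV l} = range (\<lambda>x y. B x y)"

definition lsc_on_topology :: "'c topology \<Rightarrow> ('c \<Rightarrow> ereal) \<Rightarrow> bool" where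
  "lsc_on_topology T g \<longleftrightarrow> (\<forall>c. openin T {x \<in> topspace T. c < g x})"

definition convex_ereal :: "('v::real_vector \<Rightarrow> ereal) \<Rightarrow> bool" where
  "convex_ereal g \<longleftrightarrow> (\<forall>x y. \<forall>u\<ge>0. \<forall>v\<ge>0. u + v = 1 \<longrightarrow>
     g (u *\<^sub>R x + v *\<^sub>R y) \<le> ereal u * g x + ereal v * g y)"

definition Gamma_class :: "('a::real_lctvs \<Rightarrow> ereal) set" where
  "Gamma_class = {\<phi>. convex_ereal \<phi> \<and> lsc_on_topology euclidean \<phi> \<and>
     (\<forall>x. \<phi> x \<noteq> - \<infinity>) \<and> (\<exists>x. \<phi> x \<noteq> \<infinity>)}"

definition polar_fun :: "('a \<Rightarrow> 'b \<Rightarrow> real) \<Rightarrow> ('a \<Rightarrow> ereal) \<Rightarrow> 'b \<Rightarrow> ereal" where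
  "polar_fun B \<phi> y = (SUP x. ereal (B x y) - \<phi> x)"

definition lagrangian_graph :: "('a \<Rightarrow> 'b \<Rightarrow> real) \<Rightarrow> ('a \<Rightarrow> ereal) \<Rightarrow> ('a \<times> 'b) set" where
  "lagrangian_graph B \<phi> = {(x, y). \<phi> x + polar_fun B \<phi> y = ereal (B x y)}"

text \<open>
  The subdifferential with respect to a pairing \<open>B\<close>. For a function on the second space of the
  duality, take the flipped pairing \<open>\<lambda>y x. B x y\<close>.
\<close>

definition subdifferential ::
  "('a::real_vector \<Rightarrow> 'b \<Rightarrow> real) \<Rightarrow> ('a \<Rightarrow> ereal) \<Rightarrow> 'a \<Rightarrow> 'b set" where
  "subdifferential B \<phi> x =
     (if \<phi> x < \<infinity> then {u. \<forall>z. ereal (B (z - x) u) \<le> \<phi> z - \<phi> x} else {})"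

definition bipotential ::
  "('a::real_lctvs \<Rightarrow> 'b::real_lctvs \<Rightarrow> real) \<Rightarrow> ('a \<Rightarrow> 'b \<Rightarrow> ereal) \<Rightarrow> bool" where
  "bipotential B b \<longleftrightarrow>
     (\<forall>x y. b x y \<noteq> - \<infinity>) \<and>
     (\<forall>y. convex_ereal (\<lambda>x. b x y) \<and> lsc_on_topology euclidean (\<lambda>x. b x y)) \<and>
     (\<forall>x. convex_ereal (\<lambda>y. b x y) \<and> lsc_on_topology euclidean (\<lambda>y. b x y)) \<and>
     (\<forall>x y. ereal (B x y) \<le> b x y) \<and>
     (\<forall>x y.
        (y \<in> subdifferential B (\<lambda>z. b z y) x \<longleftrightarrow>
           x \<in> subdifferential (\<lambda>v u. B u v) (\<lambda>v. b x v) y) \<and>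
        (x \<in> subdifferential (\<lambda>v u. B u v) (\<lambda>v. b x v) y \<longleftrightarrow> b x y = ereal (B x y)))"

definition bipotential_graph ::
  "('a \<Rightarrow> 'b \<Rightarrow> real) \<Rightarrow> ('a \<Rightarrow> 'b \<Rightarrow> ereal) \<Rightarrow> ('a \<times> 'b) set" where
  "bipotential_graph B b = {(x, y). b x y = ereal (B x y)}"

definition BB_graph :: "('a::real_lctvs \<times> 'b::real_lctvs) set \<Rightarrow> bool" where
  "BB_graph M \<longleftrightarrow> M \<noteq> {} \<and>
     (\<forall>x. {y. (x, y) \<in> M} \<noteq> {} \<longrightarrow> convex {y. (x, y) \<in> M} \<and> closed {y. (x, y) \<in> M}) \<and>
     (\<forall>y. {x. (x, y) \<in> M} \<noteq> {} \<longrightarrow> convex {x. (x, y) \<in> M} \<and> closed {x. (x, y) \<in> M})"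

definition cover_fun ::
  "('a \<Rightarrow> 'b \<Rightarrow> real) \<Rightarrow> ('l \<Rightarrow> 'a \<Rightarrow> ereal) \<Rightarrow> 'l \<Rightarrow> 'a \<Rightarrow> 'b \<Rightarrow> ereal" where
  "cover_fun B \<phi> l x y = \<phi> l x + polar_fun B (\<phi> l) y"

text \<open>The index space of a cover is the carrier \<^term>\<open>topspace L\<close> of an abstract topology \<open>L\<close>.\<close>

definition convex_lagrangian_cover ::
  "('a::real_lctvs \<Rightarrow> 'b::real_lctvs \<Rightarrow> real) \<Rightarrow> 'l topology \<Rightarrow> ('l \<Rightarrow> 'a \<Rightarrow> ereal) \<Rightarrow>
   ('a \<times> 'b) set \<Rightarrow> bool" where
  "convex_lagrangian_cover B L \<phi> M \<longleftrightarrow>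
     M \<noteq> {} \<and>
     (\<forall>l \<in> topspace L. \<phi> l \<in> Gamma_class) \<and>
     topspace L \<noteq> {} \<and> compact_space L \<and>
     (\<forall>x. lsc_on_topology (prod_topology L euclidean) (\<lambda>(l, y). cover_fun B \<phi> l x y)) \<and>
     (\<forall>y. lsc_on_topology (prod_topology L euclidean) (\<lambda>(l, x). cover_fun B \<phi> l x y)) \<and>
     M = (\<Union>l \<in> topspace L. lagrangian_graph B (\<phi> l))"

definition implicitly_convex :: "'l set \<Rightarrow> ('l \<Rightarrow> 'v::real_vector \<Rightarrow> ereal) \<Rightarrow> bool" where
  "implicitly_convex \<Lambda> g \<longleftrightarrow>
     (\<forall>l1 \<in> \<Lambda>. \<forall>l2 \<in> \<Lambda>. \<forall>z1 z2. \<forall>u \<in> {0..1}. \<forall>v \<in> {0..1}. u + v = 1 \<longrightarrow>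
        (\<exists>l \<in> \<Lambda>. g l (u *\<^sub>R z1 + v *\<^sub>R z2) \<le> ereal u * g l1 z1 + ereal v * g l2 z2))"

definition BIC_cover ::
  "('a::real_lctvs \<Rightarrow> 'b::real_lctvs \<Rightarrow> real) \<Rightarrow> 'l topology \<Rightarrow> ('l \<Rightarrow> 'a \<Rightarrow> ereal) \<Rightarrow>
   ('a \<times> 'b) set \<Rightarrow> bool" where
  "BIC_cover B L \<phi> M \<longleftrightarrow> convex_lagrangian_cover B L \<phi> M \<and>
     (\<forall>y. implicitly_convex (topspace L) (\<lambda>l x. cover_fun B \<phi> l x y)) \<and>
     (\<forall>x. implicitly_convex (topspace L) (\<lambda>l y. cover_fun B \<phi> l x y))"

end

theory Submission
  imports Defs
begin

text \<open>
  By compactness of \<open>\<Lambda>\<close> and lower semicontinuity the infimum defining \<open>b\<close> is attained. Hence \<open>b\<close> is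
  lower semicontinuous in each argument (projection along a compact space is a closed map), convex in
  each argument (implicit convexity), and \<open>b(x,y) = \<langle>x,y\<rangle>\<close> exactly on \<open>M\<close>. If \<open>y\<close> is a subgradient
  of \<open>b(\<cdot>,y)\<close> at \<open>x\<close>, it is also one of \<open>\<phi>\<^sub>\<lambda> + \<phi>\<^sub>\<lambda>\<^sup>*(y)\<close> for a minimising \<open>\<lambda>\<close>, which is the case of
  equality in Fenchel-Young. In the other variable the same argument needs \<open>\<phi>\<^sub>\<lambda>\<^sup>*\<^sup>*(x) = \<phi>\<^sub>\<lambda>(x)\<close>, but only
  where \<open>\<phi>\<^sub>\<lambda>(x)\<close> is finite; this comes from a Hahn-Banach argument.
\<close>

section \<open>Hahn-Banach for convex cones\<close>

text \<open>The Hahn-Banach theorem: \<open>K\<close> plays the role of the epigraph of a sublinear functional, and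
  a maximal such cone is the epigraph of a linear one.\<close>

lemma linear_minorant_convex_cone:
  fixes K :: "('v::real_vector \<times> real) set"
  assumes K: "convex_cone K" and dom: "\<And>h. \<exists>a. (h, a) \<in> K"
    and nonneg: "\<And>a. (0, a) \<in> K \<Longrightarrow> 0 \<le> a"
  shows "\<exists>l. linear l \<and> (\<forall>(h, a) \<in> K. l h \<le> a)"
proof -
  \<comment> \<open>Enlarging an epigraph lowers its functional, so a maximal member of
    \<open>\<A>\<close> belongs to a minimal sublinear functional. The condition on the fibre over 0
    is what keeps that functional finite.\<close>
  define \<A> where "\<A> = {C. convex_cone C \<and> K \<subseteq> C \<and> (\<forall>a. (0, a) \<in> C \<longrightarrow> 0 \<le> a)}"
  have "\<exists>C\<in>\<A>. \<forall>X\<in>\<A>. C \<subseteq> X \<longrightarrow> X = C"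
  proof (rule subset_Zorn_nonempty)
    show "\<A> \<noteq> {}" using K nonneg by (auto simp: \<A>_def)
    fix \<C> assume ne: "\<C> \<noteq> {}" and ch: "subset.chain \<A> \<C>"
    then have mem: "C \<in> \<C> \<Longrightarrow> C \<in> \<A>" for C by (auto simp: subset.chain_def)
    have "x + y \<in> \<Union>\<C>" if "x \<in> \<Union>\<C>" "y \<in> \<Union>\<C>" for x y
    proof -
      from that obtain C D where CD: "C \<in> \<C>" "D \<in> \<C>" "x \<in> C" "y \<in> D" by blast
      then have "C \<subseteq> D \<or> D \<subseteq> C" using ch by (auto simp: subset_chain_def)
      then have "x + y \<in> C \<or> x + y \<in> D"
        using CD mem[of C] mem[of D] by (auto simp: \<A>_def intro: convex_cone_add)
      then show ?thesis using CD by blast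
    qed
    moreover have "c *\<^sub>R x \<in> \<Union>\<C>" if "x \<in> \<Union>\<C>" "0 \<le> c" for x and c :: real
      using that mem by (auto simp: \<A>_def intro!: convex_cone_scaleR)
    moreover have "0 \<in> \<Union>\<C>"
    proof -
      obtain C where "C \<in> \<C>" using ne by blast
      then show ?thesis using mem[of C] by (auto simp: \<A>_def intro: convex_cone_contains_0)
    qed
    ultimately have "convex_cone (\<Union>\<C>)" by (simp add: convex_cone_iff)
    moreover have "K \<subseteq> \<Union>\<C>"
    proof -
      obtain C where "C \<in> \<C>" using ne by blast
      then show ?thesis using mem[of C] by (auto simp: \<A>_def)
    qed
    moreover have "0 \<le> a" if "(0, a) \<in> \<Union>\<C>" for a
    proof -
      from that obtain C where "C \<in> \<C>" "(0, a) \<in> C" by blast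
      then show ?thesis using mem[of C] by (simp add: \<A>_def)
    qed
    ultimately show "\<Union>\<C> \<in> \<A>" by (simp add: \<A>_def)
  qed
  then obtain C where "C \<in> \<A>" and max: "\<And>X. X \<in> \<A> \<Longrightarrow> C \<subseteq> X \<Longrightarrow> X = C"
    by blast
  then have C: "convex_cone C" "K \<subseteq> C" "\<And>a. (0, a) \<in> C \<Longrightarrow> 0 \<le> a"
    by (simp_all add: \<A>_def)
  define p where "p h = Inf {a. (h, a) \<in> C}" for h
  have le: "p h \<le> a" if "(h, a) \<in> C" for h a
  proof -
    \<comment> \<open>Any point of the fibre over \<open>- h\<close> bounds the fibre over
      \<open>h\<close> from below, so \<open>p h\<close> is a genuine infimum of reals.\<close>
    obtain c where "(- h, c) \<in> C" using dom C(2) by blast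
    then have "- c \<le> a" if "(h, a) \<in> C" for a
      using C(3) convex_cone_add[OF C(1) that] by fastforce
    then show ?thesis unfolding p_def using that by (intro cInf_lower bdd_belowI) auto
  qed
  \<comment> \<open>Here maximality enters. \<open>D\<close> is \<open>C\<close> enlarged by the ray
    through \<open>(- k, - p k)\<close>. Its fibre over 0 stays nonnegative, since
    \<open>(t *\<^sub>R k, a)\<close> in \<open>C\<close> gives \<open>t * p k \<le> a\<close> after
    rescaling. Hence \<open>D = C\<close>.\<close>
  have neg: "(- k, - p k) \<in> C" for k
  proof -
    define D where "D = {(h - t *\<^sub>R k, a - t * p k) | h a t. (h, a) \<in> C \<and> 0 \<le> t}"
    have sub: "C \<subseteq> D" unfolding D_def by force
    have "x + y \<in> D" if "x \<in> D" "y \<in> D" for x y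
    proof -
      obtain h a t h' a' t' where *: "x = (h - t *\<^sub>R k, a - t * p k)" "y = (h' - t' *\<^sub>R k, a' - t' * p k)"
        "(h, a) \<in> C" "(h', a') \<in> C" "0 \<le> t" "0 \<le> t'"
        using \<open>x \<in> D\<close> \<open>y \<in> D\<close> unfolding D_def by blast
      then have "(h + h', a + a') \<in> C" using convex_cone_add[OF C(1), of "(h, a)" "(h', a')"] by simp
      moreover have "x + y = ((h + h') - (t + t') *\<^sub>R k, (a + a') - (t + t') * p k)"
        using * by (simp add: algebra_simps)
      ultimately show ?thesis using * unfolding D_def by fastforce
    qed
    moreover have "c *\<^sub>R x \<in> D" if "x \<in> D" "0 \<le> c" for x and c :: real
    proof -
      obtain h a t where *: "x = (h - t *\<^sub>R k, a - t * p k)" "(h, a) \<in> C" "0 \<le> t"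
        using \<open>x \<in> D\<close> unfolding D_def by blast
      then have "(c *\<^sub>R h, c * a) \<in> C"
        using convex_cone_scaleR[OF C(1) \<open>0 \<le> c\<close>, of "(h, a)"] by simp
      moreover have "c *\<^sub>R x = (c *\<^sub>R h - (c * t) *\<^sub>R k, c * a - (c * t) * p k)"
        using * by (simp add: algebra_simps)
      moreover have "0 \<le> c * t" using * \<open>0 \<le> c\<close> by simp
      ultimately show ?thesis unfolding D_def by blast
    qed
    moreover have "0 \<in> D" using sub convex_cone_contains_0[OF C(1)] by blast
    ultimately have "convex_cone D" by (simp add: convex_cone_iff)
    moreover have "0 \<le> a'" if "(0, a') \<in> D" for a'
    proof -
      obtain a t where a: "(t *\<^sub>R k, a) \<in> C" "0 \<le> t" "a' = a - t * p k"
        using \<open>(0, a') \<in> D\<close> unfolding D_def by auto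
      show ?thesis
      proof (cases "t = 0")
        case True
        then show ?thesis using a C(3) by simp
      next
        case False
        then have "(k, a / t) \<in> C"
          using convex_cone_scaleR[OF C(1), of "1 / t" "(t *\<^sub>R k, a)"] a by simp
        then have "p k \<le> a / t" by (rule le)
        then show ?thesis using a False by (simp add: field_simps)
      qed
    qed
    ultimately have "D \<in> \<A>" using sub C(2) by (auto simp: \<A>_def)
    then have "D = C" using sub by (rule max)
    moreover have "(- k, - p k) \<in> D"
      unfolding D_def mem_Collect_eq using convex_cone_contains_0[OF C(1)]
      by (intro exI[of _ 0] exI[of _ 1]) (simp add: zero_prod_def)
    ultimately show ?thesis by simp
  qed
  have ge: "d \<le> p h" if "\<And>a. (h, a) \<in> C \<Longrightarrow> d \<le> a" for d h
  proof -
    obtain a where "(h, a) \<in> C" using dom C(2) by blast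
    then show ?thesis unfolding p_def using that by (intro cInf_greatest) auto
  qed
  \<comment> \<open>Points of the fibres over \<open>k\<close> and \<open>- k\<close> add up to a
    point over 0, which bounds their sum below by 0. Together with \<open>neg\<close> this makes
    \<open>p\<close> odd.\<close>
  have "- p k \<le> p (- k)" for k
  proof (rule ge)
    fix c assume c: "(- k, c) \<in> C"
    have "- c \<le> p k"
    proof (rule ge)
      show "- c \<le> a" if "(k, a) \<in> C" for a
        using C(3) convex_cone_add[OF C(1) c that] by fastforce
    qed
    then show "- p k \<le> c" by simp
  qed
  then have odd: "p (- k) = - p k" for k
    using le[OF neg[of k]] by (simp add: order_antisym)
  \<comment> \<open>By oddness, \<open>neg\<close> at \<open>- k\<close> says that the infimum
    \<open>p k\<close> is attained. The cone axioms then make \<open>p\<close> sublinear, and for an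
    odd functional the same inequalities at negated arguments turn into equalities.\<close>
  have pC: "(k, p k) \<in> C" for k
    using neg[of "- k"] odd[of k] by simp
  have sub: "p (h + k) \<le> p h + p k" for h k
    using convex_cone_add[OF C(1) pC[of h] pC[of k]] by (intro le) simp
  have hom: "p (r *\<^sub>R h) \<le> r * p h" if "0 \<le> r" for r h
    using convex_cone_scaleR[OF C(1) that pC[of h]] by (intro le) simp
  have hom_eq: "p (r *\<^sub>R h) = r * p h" if "0 \<le> r" for r h
    using hom[OF that, of h] hom[OF that, of "- h"] odd[of h] odd[of "r *\<^sub>R h"] by simp
  have "linear p"
  proof (rule linearI)
    show "p (h + k) = p h + p k" for h k
      using sub[of h k] sub[of "- h" "- k"] odd[of h] odd[of k] odd[of "h + k"] by simp
    show "p (r *\<^sub>R h) = r *\<^sub>R p h" for r h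
      using hom_eq[of r h] hom_eq[of "- r" h] odd[of "r *\<^sub>R h"] by (cases "0 \<le> r") auto
  qed
  then show ?thesis using le C(2) by blast
qed

section \<open>Continuous affine minorants in locally convex spaces\<close>

lemma tendsto_scaleR_compose_lctvs:
  fixes g :: "'t \<Rightarrow> 'a::real_lctvs"
  assumes "(f \<longlongrightarrow> r) F" "(g \<longlongrightarrow> a) F"
  shows "((\<lambda>t. f t *\<^sub>R g t) \<longlongrightarrow> r *\<^sub>R a) F"
  using filterlim_compose[OF tendsto_scaleR_lctvs filterlim_Pair[OF assms]] by simp

text \<open>Scaling a small displacement into \<open>V\<close> makes the bound \<open>N\<close>
  arbitrarily small after scaling back. A one-sided bound is enough because a displacement and its
  negative both end up in \<open>V\<close>.\<close>

lemma linear_continuous_on_if_bounded_below: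
  fixes l :: "'a::real_lctvs \<Rightarrow> real"
  assumes l: "linear l" and V: "open V" "0 \<in> V" and bd: "\<And>h. h \<in> V \<Longrightarrow> - N \<le> l h"
  shows "continuous_on UNIV l"
  unfolding continuous_on_def
proof
  fix a
  have N: "0 \<le> N" using bd[OF V(2)] linear_0[OF l] by simp
  show "(l \<longlongrightarrow> l a) (at a within UNIV)"
  proof (rule tendstoI)
    fix e :: real assume e: "0 < e"
    \<comment> \<open>Chosen so that \<open>N < k * e\<close>; the 1 keeps \<open>k\<close> positive
      when \<open>N = 0\<close>.\<close>
    define k where "k = (N + 1) / e"
    have k: "0 < k" using N e by (simp add: k_def)
    have "((\<lambda>y. k *\<^sub>R (y - a)) \<longlongrightarrow> k *\<^sub>R (a + - a)) (at a)"
      "((\<lambda>y. k *\<^sub>R (a - y)) \<longlongrightarrow> k *\<^sub>R (a + - a)) (at a)"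
      unfolding diff_conv_add_uminus
      by (intro tendsto_scaleR_compose_lctvs tendsto_add tendsto_minus tendsto_const tendsto_ident_at)+
    then have "((\<lambda>y. k *\<^sub>R (y - a)) \<longlongrightarrow> 0) (at a)" "((\<lambda>y. k *\<^sub>R (a - y)) \<longlongrightarrow> 0) (at a)"
      by simp_all
    then have "\<forall>\<^sub>F y in at a. k *\<^sub>R (y - a) \<in> V" "\<forall>\<^sub>F y in at a. k *\<^sub>R (a - y) \<in> V"
      using V by (auto dest: topological_tendstoD)
    then show "\<forall>\<^sub>F y in at a within UNIV. dist (l y) (l a) < e"
    proof eventually_elim
      case (elim y)
      have "- N \<le> k * (l y - l a)" "- N \<le> k * (l a - l y)"
        using bd[OF elim(1)] bd[OF elim(2)] by (simp_all add: linear_cmul[OF l] linear_diff[OF l])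
      then have "k * \<bar>l y - l a\<bar> \<le> N" by (auto simp: abs_if algebra_simps)
      then have "k * \<bar>l y - l a\<bar> < k * e" using e by (simp add: k_def)
      then show ?case using k by (simp add: dist_real_def)
    qed
  qed
qed

text \<open>
  With \<open>C\<close> a convex neighbourhood of \<open>x\<close> on which \<open>\<phi> > c\<close>, the cone \<open>K\<close> below is spanned by the
  epigraph of \<open>\<phi>(x + \<cdot>) - c\<close> and by \<open>(x - C) \<times> {\<phi>(x) - c}\<close>. The first part makes a linear minorant
  of \<open>K\<close> a minorant of \<open>\<phi>\<close>, the second makes it continuous.
\<close>

lemma continuous_affine_minorant:
  fixes \<phi> :: "'a::real_lctvs \<Rightarrow> ereal"
  assumes cvx: "convex_ereal \<phi>" and lsc: "lsc_on_topology euclidean \<phi>"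
    and ninf: "\<And>z. \<phi> z \<noteq> - \<infinity>" and r: "\<phi> x = ereal r" and c: "c < r"
  shows "\<exists>l. linear l \<and> continuous_on UNIV l \<and> (\<forall>z. ereal (l (z - x) + c) \<le> \<phi> z)"
proof -
  define N where "N = r - c"
  have N: "0 < N" using c by (simp add: N_def)
  have "open {z. ereal c < \<phi> z}" using lsc by (auto simp: lsc_on_topology_def)
  then obtain C V where C: "convex C" "open V" "x \<in> V" "V \<subseteq> C" "C \<subseteq> {z. ereal c < \<phi> z}"
    using locally_convex[of "{z. ereal c < \<phi> z}" x] r c by auto
  define E where "E = {(w, a). \<phi> (x + w) \<le> ereal (a + c)}"
  define D where "D = {(w, a). x - w \<in> C \<and> a = N}"
  have "convex E"
  proof (rule convexI)
    fix p q :: "'a \<times> real" and u v :: real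
    assume pq: "p \<in> E" "q \<in> E" and uv: "0 \<le> u" "0 \<le> v" "u + v = 1"
    obtain w a w' a' where p: "p = (w, a)" "q = (w', a')" by (cases p, cases q)
    have eq: "x + (u *\<^sub>R w + v *\<^sub>R w') = u *\<^sub>R (x + w) + v *\<^sub>R (x + w')"
      using uv(3) by (simp add: algebra_simps flip: scaleR_add_left)
    have "\<phi> (x + (u *\<^sub>R w + v *\<^sub>R w')) \<le> ereal u * \<phi> (x + w) + ereal v * \<phi> (x + w')"
      unfolding eq using cvx uv unfolding convex_ereal_def by blast
    also have "\<dots> \<le> ereal u * ereal (a + c) + ereal v * ereal (a' + c)"
      using pq uv by (intro add_mono ereal_mult_left_mono) (auto simp: p E_def)
    also have "\<dots> = ereal ((u * a + v * a') + (u + v) * c)"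
      by (simp add: algebra_simps)
    finally show "u *\<^sub>R p + v *\<^sub>R q \<in> E" using uv(3) by (simp add: p E_def)
  qed
  have "convex D"
  proof (rule convexI)
    fix p q :: "'a \<times> real" and u v :: real
    assume pq: "p \<in> D" "q \<in> D" and uv: "0 \<le> u" "0 \<le> v" "u + v = 1"
    obtain w w' where p: "p = (w, N)" "q = (w', N)" "x - w \<in> C" "x - w' \<in> C"
      using pq by (auto simp: D_def)
    have "u *\<^sub>R (x - w) + v *\<^sub>R (x - w') \<in> C"
      using C(1) p uv unfolding convex_def by blast
    also have "u *\<^sub>R (x - w) + v *\<^sub>R (x - w') = (u + v) *\<^sub>R x - (u *\<^sub>R w + v *\<^sub>R w')"
      by (simp add: algebra_simps)
    finally have "x - (u *\<^sub>R w + v *\<^sub>R w') \<in> C" using uv by simp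
    moreover have "u * N + v * N = N" using uv by (metis distrib_right mult_1)
    ultimately show "u *\<^sub>R p + v *\<^sub>R q \<in> D" by (simp add: D_def p)
  qed
  have E0: "(0, N) \<in> E" by (simp add: E_def N_def r)
  have D0: "(0, N) \<in> D" using C by (auto simp: D_def)
  define K where "K = (\<Union>p \<in> conic hull E. \<Union>q \<in> conic hull D. {p + q})"
  have "convex_cone (conic hull E)" "convex_cone (conic hull D)"
    using \<open>convex E\<close> \<open>convex D\<close> hull_inc[OF E0, of conic] hull_inc[OF D0, of conic]
    by (auto simp: convex_cone_def convex_conic_hull conic_conic_hull)
  then have cone: "convex_cone K" unfolding K_def by (rule convex_cone_sums)
  have KI: "(s *\<^sub>R w + t *\<^sub>R h, s * a + t * N) \<in> K"
    if "\<phi> (x + w) \<le> ereal (a + c)" "x - h \<in> C" "0 \<le> s" "0 \<le> t" for w h a s t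
  proof -
    have "s *\<^sub>R (w, a) \<in> conic hull E" "t *\<^sub>R (h, N) \<in> conic hull D"
      using that unfolding conic_hull_explicit E_def D_def by blast+
    then show ?thesis unfolding K_def by force
  qed
  \<comment> \<open>The neighbourhood \<open>V\<close> absorbs: for small \<open>t > 0\<close> the
    point \<open>x - t *\<^sub>R h\<close> lies in \<open>C\<close>, so
    \<open>(t *\<^sub>R h, N)\<close> is in \<open>D\<close> and can be scaled by
    \<open>1 / t\<close>.\<close>
  have dom: "\<exists>a. (h, a) \<in> K" for h
  proof -
    have "((\<lambda>t. x + - (t *\<^sub>R h)) \<longlongrightarrow> x + - (0 *\<^sub>R h)) (at_right (0::real))"
      by (intro tendsto_add tendsto_minus tendsto_scaleR_compose_lctvs tendsto_const tendsto_ident_at)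
    then have "\<forall>\<^sub>F t in at_right (0::real). x - t *\<^sub>R h \<in> V"
      using C by (auto dest: topological_tendstoD)
    moreover have "\<forall>\<^sub>F t in at_right (0::real). 0 < t" by (simp add: eventually_at_right_less)
    ultimately have "\<forall>\<^sub>F t in at_right (0::real). x - t *\<^sub>R h \<in> V \<and> 0 < t" by eventually_elim simp
    then obtain t where "x - t *\<^sub>R h \<in> V" "0 < t"
      using eventually_happens' trivial_limit_at_right_real by blast
    then show ?thesis
      using KI[of 0 N "t *\<^sub>R h" 0 "1 / t"] C(4) by (auto simp: r N_def)
  qed
  \<comment> \<open>If \<open>s *\<^sub>R w + t *\<^sub>R h = 0\<close> with \<open>s\<close>,
    \<open>t\<close> not both 0, then \<open>x\<close>, \<open>x + w\<close> and
    \<open>x - h\<close> are collinear. For \<open>s \<le> t\<close> the point \<open>x - h\<close>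
    lies between \<open>x\<close> and \<open>x + w\<close>, and convexity of \<open>\<phi>\<close>
    plays against \<open>\<phi> > c\<close> on \<open>C\<close>. For \<open>s > t\<close> the point
    \<open>x + w\<close> lies between \<open>x\<close> and \<open>x - h\<close>, hence in
    \<open>C\<close>, which forces \<open>e > 0\<close>.\<close>
  have nonneg: "0 \<le> a" if mem: "(0, a) \<in> K" for a
  proof -
    obtain s w e t h where *: "0 \<le> s" "0 \<le> t" "s *\<^sub>R w + t *\<^sub>R h = 0" "a = s * e + t * N"
      "\<phi> (x + w) \<le> ereal (e + c)" "x - h \<in> C"
      using mem unfolding K_def conic_hull_explicit E_def D_def by (fastforce simp: zero_prod_def)
    have tsh: "t *\<^sub>R (- h) = s *\<^sub>R w" using *(3) by (simp add: neg_eq_iff_add_eq_0 add.commute)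
    show ?thesis
    proof (cases "s \<le> t")
      case True
      show ?thesis
      proof (cases "t = 0")
        case True
        then show ?thesis using * \<open>s \<le> t\<close> by simp
      next
        case False
        then have t: "0 < t" using * by simp
        define \<theta> where "\<theta> = s / t"
        have \<theta>: "0 \<le> \<theta>" "\<theta> \<le> 1" using True t * by (auto simp: \<theta>_def)
        have h: "- h = \<theta> *\<^sub>R w"
        proof -
          have "- h = (1 / t) *\<^sub>R (t *\<^sub>R (- h))" using t by simp
          then show ?thesis unfolding tsh by (simp add: \<theta>_def)
        qed
        then have "x - h = x + \<theta> *\<^sub>R w" by (metis diff_conv_add_uminus)
        then have "x - h = (1 - \<theta>) *\<^sub>R x + \<theta> *\<^sub>R (x + w)"
          by (simp add: algebra_simps)
        then have "\<phi> (x - h) \<le> ereal (1 - \<theta>) * \<phi> x + ereal \<theta> * \<phi> (x + w)"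
          using cvx \<theta> unfolding convex_ereal_def by simp
        also have "\<dots> \<le> ereal (1 - \<theta>) * ereal r + ereal \<theta> * ereal (e + c)"
          using \<theta> * r by (intro add_mono ereal_mult_left_mono) auto
        finally have "\<phi> (x - h) \<le> ereal ((1 - \<theta>) * r + \<theta> * (e + c))" by simp
        moreover have "ereal c < \<phi> (x - h)" using * C(5) by auto
        ultimately have "ereal c < ereal ((1 - \<theta>) * r + \<theta> * (e + c))" by (rule less_le_trans[rotated])
        then have "0 < (1 - \<theta>) * N + \<theta> * e" by (simp add: N_def algebra_simps)
        then have "0 < t * ((1 - \<theta>) * N + \<theta> * e)" using t by simp
        also have "\<dots> = (t - s) * N + s * e" using t by (simp add: \<theta>_def field_simps)
        also have "\<dots> \<le> a" using *(1,4) N by (simp add: algebra_simps)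
        finally show ?thesis by simp
      qed
    next
      case False
      then have s: "0 < s" using * by simp
      define \<theta> where "\<theta> = t / s"
      have \<theta>: "0 \<le> \<theta>" "\<theta> \<le> 1" using False s * by (auto simp: \<theta>_def)
      have "w = (1 / s) *\<^sub>R (s *\<^sub>R w)" using s by simp
      then have "w = \<theta> *\<^sub>R (- h)" unfolding tsh[symmetric] by (simp add: \<theta>_def)
      then have "x + w = (1 - \<theta>) *\<^sub>R x + \<theta> *\<^sub>R (x - h)" by (simp add: algebra_simps)
      also have "\<dots> \<in> C"
        using C(1,3,4) \<theta> *(6) by (intro convexD) auto
      finally have "ereal c < \<phi> (x + w)" using C(5) by auto
      then have "ereal c < ereal (e + c)" using *(5) by (rule less_le_trans)
      then show ?thesis using * N by simp
    qed
  qed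
  obtain l where l: "linear l" and le: "\<And>h a. (h, a) \<in> K \<Longrightarrow> l h \<le> a"
    using linear_minorant_convex_cone[OF cone dom nonneg] by blast
  \<comment> \<open>The generators in \<open>D\<close> give \<open>l (- h) \<le> N\<close> whenever
    \<open>x + h\<close> is in \<open>C\<close>, a lower bound for \<open>l\<close> near 0.\<close>
  have "continuous_on UNIV l"
  proof (rule linear_continuous_on_if_bounded_below[OF l])
    have "continuous_on UNIV (\<lambda>h. x + h)"
      unfolding continuous_on_def by (intro ballI tendsto_add tendsto_const tendsto_ident_at)
    then show "open ((\<lambda>h. x + h) -` V)" using C(2) by (simp add: continuous_on_open_vimage)
    show "0 \<in> (\<lambda>h. x + h) -` V" using C(3) by simp
    show "- N \<le> l h" if "h \<in> (\<lambda>h. x + h) -` V" for h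
      using le[OF KI[of 0 N "- h" 0 1]] that C(4) linear_neg[OF l, of h] by (auto simp: r N_def)
  qed
  moreover have "ereal (l (z - x) + c) \<le> \<phi> z" for z
  proof (cases "\<phi> z")
    case (real a)
    then show ?thesis
      using le[OF KI[of "z - x" "a - c" 0 1 0]] C(3,4) by auto
  qed (use ninf in auto)
  ultimately show ?thesis using l by blast
qed

section \<open>Polar functions and the biconjugate\<close>

lemma polar_fun_ge: "ereal (B x y) - \<phi> x \<le> polar_fun B \<phi> y"
  unfolding polar_fun_def by (rule SUP_upper) simp

lemma polar_fun_neq_MInf:
  assumes "\<phi> \<in> Gamma_class"
  shows "polar_fun B \<phi> y \<noteq> - \<infinity>"
proof -
  obtain x where "\<phi> x \<noteq> \<infinity>" using assms by (auto simp: Gamma_class_def)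
  then have "ereal (B x y) - \<phi> x \<noteq> - \<infinity>" by (cases "\<phi> x") auto
  then show ?thesis using polar_fun_ge[of B x y \<phi>] by auto
qed

lemma Fenchel_Young:
  assumes "\<phi> \<in> Gamma_class"
  shows "ereal (B x y) \<le> \<phi> x + polar_fun B \<phi> y"
  using polar_fun_ge[of B x y \<phi>] polar_fun_neq_MInf[OF assms, of B y] assms
  by (cases "\<phi> x"; cases "polar_fun B \<phi> y") (auto simp: Gamma_class_def)

text \<open>This is the nontrivial half of \<open>\<phi>** = \<phi>\<close> at a point of
  finiteness: the bound says that \<open>B x y - \<phi>*(y)\<close> is at least \<open>c\<close>,
  for any \<open>c\<close> below \<open>\<phi> x\<close>. Compatibility of the duality represents
  the slope of a continuous affine minorant by some \<open>y\<close>.\<close>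

lemma Fenchel_Moreau_at:
  assumes B: "compatible_duality B" and \<phi>: "\<phi> \<in> Gamma_class"
    and r: "\<phi> x = ereal r" and c: "c < r"
  shows "\<exists>y. polar_fun B \<phi> y \<le> ereal (B x y - c)"
proof -
  have ninf: "\<phi> z \<noteq> - \<infinity>" for z using \<phi> by (simp add: Gamma_class_def)
  obtain l where l: "linear l" "continuous_on UNIV l" "\<And>z. ereal (l (z - x) + c) \<le> \<phi> z"
    using continuous_affine_minorant[of \<phi>, OF _ _ ninf r c] \<phi> by (auto simp: Gamma_class_def)
  have "l \<in> {l. linear l \<and> continuous_on UNIV l}" using l by simp
  also have "\<dots> = range (\<lambda>y x. B x y)" using B by (simp add: compatible_duality_def)
  finally obtain y where y: "l = (\<lambda>x. B x y)" by blast
  have "ereal (B z y) - \<phi> z \<le> ereal (B x y - c)" for z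
    using l(3)[of z] linear_diff[OF l(1), of z x] ninf[of z]
    by (cases "\<phi> z") (auto simp: y)
  then show ?thesis unfolding polar_fun_def by (auto intro: SUP_least)
qed

section \<open>Infima over a compact index space\<close>

lemma lsc_on_topology_slice:
  assumes "lsc_on_topology (prod_topology L T) (\<lambda>(l, x). g l x)" and x: "x \<in> topspace T"
  shows "lsc_on_topology L (\<lambda>l. g l x)"
  unfolding lsc_on_topology_def
proof
  fix c
  have "continuous_map L (prod_topology L T) (\<lambda>l. (l, x))"
    using x by (simp add: continuous_map_pairedI)
  moreover have "openin (prod_topology L T) {p \<in> topspace (prod_topology L T). c < (case p of (l, x) \<Rightarrow> g l x)}"
    using assms(1) by (simp add: lsc_on_topology_def)
  ultimately have "openin L {l \<in> topspace L. (l, x) \<in> {p \<in> topspace (prod_topology L T). c < (case p of (l, x) \<Rightarrow> g l x)}}"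
    by (rule openin_continuous_map_preimage)
  then show "openin L {l \<in> topspace L. c < g l x}"
    using x by (simp cong: conj_cong)
qed

text \<open>Were the infimum \<open>m\<close> not attained, the open sets \<open>{g > c}\<close>
  with \<open>c > m\<close> would cover the space. The least level of a finite subcover would then
  be a lower bound of \<open>g\<close> above \<open>m\<close>.\<close>

lemma lsc_on_compact_attains_INF:
  assumes L: "compact_space L" "topspace L \<noteq> {}" and g: "lsc_on_topology L g"
  shows "\<exists>l \<in> topspace L. g l = (INF l \<in> topspace L. g l)"
proof (rule ccontr)
  define m where "m = (INF l \<in> topspace L. g l)"
  assume "\<not> ?thesis"
  then have gt: "m < g l" if "l \<in> topspace L" for l
    using that INF_lower[OF that, of g] by (force simp: m_def)
  define U where "U c = {l \<in> topspace L. c < g l}" for c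
  have "topspace L \<subseteq> \<Union> (U ` {m<..})"
    using gt dense by (force simp: U_def)
  moreover have "openin L (U c)" for c using g by (simp add: U_def lsc_on_topology_def)
  ultimately obtain \<F> where \<F>: "finite \<F>" "\<F> \<subseteq> U ` {m<..}" "topspace L \<subseteq> \<Union>\<F>"
    using L(1) unfolding compact_space_alt by (metis (no_types, lifting) imageE)
  then obtain S where S: "finite S" "S \<subseteq> {m<..}" "\<F> = U ` S"
    using finite_subset_image by metis
  then have "S \<noteq> {}" using L(2) \<F> by auto
  then have "m < Min S" using S by auto
  moreover have "Min S \<le> g l" if l: "l \<in> topspace L" for l
  proof -
    obtain c where "c \<in> S" "c < g l" using \<F>(3) S(3) l by (auto simp: U_def)
    then show ?thesis using Min_le[OF S(1), of c] by simp
  qed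
  then have "Min S \<le> m" unfolding m_def by (rule INF_greatest)
  ultimately show False by simp
qed

text \<open>The sublevel set of the infimum at \<open>c\<close> is the projection of the closed set
  \<open>{g \<le> c}\<close>, and projecting along a compact factor is a closed map. Attainment
  turns \<open>c < g l x\<close> for all \<open>l\<close> into the strict inequality for the
  infimum.\<close>

lemma lsc_on_topology_INF_compact:
  assumes L: "compact_space L" "topspace L \<noteq> {}"
    and g: "lsc_on_topology (prod_topology L T) (\<lambda>(l, x). g l x)"
  shows "lsc_on_topology T (\<lambda>x. INF l \<in> topspace L. g l x)"
  unfolding lsc_on_topology_def
proof
  fix c
  let ?P = "prod_topology L T"
  define U where "U = {p \<in> topspace ?P. c < (case p of (l, x) \<Rightarrow> g l x)}"
  have "openin ?P U" using g unfolding U_def lsc_on_topology_def by blast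
  then have "closedin ?P (topspace ?P - U)" by blast
  then have "closedin T (snd ` (topspace ?P - U))"
    using closed_map_snd[OF L(1)] by (auto simp: closed_map_def)
  moreover have "topspace T - snd ` (topspace ?P - U) = {x \<in> topspace T. c < (INF l \<in> topspace L. g l x)}"
  proof (intro set_eqI iffI)
    fix x assume x: "x \<in> topspace T - snd ` (topspace ?P - U)"
    then have "c < g l x" if "l \<in> topspace L" for l
      using that by (force simp: U_def)
    moreover obtain l where "l \<in> topspace L" "g l x = (INF l \<in> topspace L. g l x)"
      using lsc_on_compact_attains_INF[OF L lsc_on_topology_slice[OF g, of x]] x by auto
    ultimately show "x \<in> {x \<in> topspace T. c < (INF l \<in> topspace L. g l x)}"
      using x by force
  next
    fix x assume "x \<in> {x \<in> topspace T. c < (INF l \<in> topspace L. g l x)}"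
    then show "x \<in> topspace T - snd ` (topspace ?P - U)"
      by (auto simp: U_def dest: less_INF_D)
  qed
  ultimately show "openin T {x \<in> topspace T. c < (INF l \<in> topspace L. g l x)}"
    by (metis openin_diff openin_topspace)
qed

text \<open>Implicit convexity is applied to minimising indices at the two endpoints; the index it
  returns bounds the infimum at the intermediate point.\<close>

lemma convex_ereal_INF_if_implicitly_convex:
  assumes g: "implicitly_convex S g"
    and att: "\<And>z. \<exists>l \<in> S. g l z = (INF l \<in> S. g l z)"
  shows "convex_ereal (\<lambda>z. INF l \<in> S. g l z)"
  unfolding convex_ereal_def
proof (intro allI impI)
  fix x y and u v :: real
  assume uv: "0 \<le> u" "0 \<le> v" "u + v = 1"
  obtain l1 l2 where l12: "l1 \<in> S" "g l1 x = (INF l \<in> S. g l x)" "l2 \<in> S" "g l2 y = (INF l \<in> S. g l y)"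
    using att by metis
  have "u \<in> {0..1}" "v \<in> {0..1}" using uv by auto
  then obtain l where "l \<in> S" "g l (u *\<^sub>R x + v *\<^sub>R y) \<le> ereal u * g l1 x + ereal v * g l2 y"
    using g l12(1,3) uv(3) unfolding implicitly_convex_def by blast
  then show "(INF l \<in> S. g l (u *\<^sub>R x + v *\<^sub>R y)) \<le>
      ereal u * (INF l \<in> S. g l x) + ereal v * (INF l \<in> S. g l y)"
    unfolding l12(2)[symmetric] l12(4)[symmetric] by (rule INF_lower2)
qed

section \<open>The bipotential of a BIC-cover\<close>

theorem theorem6p7:
  fixes B :: "'a::real_lctvs \<Rightarrow> 'b::real_lctvs \<Rightarrow> real"
    and M :: "('a \<times> 'b) set"
    and L :: "'l topology"
    and \<phi> :: "'l \<Rightarrow> 'a \<Rightarrow> ereal"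
    and b :: "'a \<Rightarrow> 'b \<Rightarrow> ereal"
  assumes "compatible_duality B"
    and "BB_graph M"
    and "BIC_cover B L \<phi> M"
    and "\<And>x y. b x y = (INF l \<in> topspace L. \<phi> l x + polar_fun B (\<phi> l) y)"
  shows "bipotential B b \<and> M = bipotential_graph B b"
proof -
  let ?\<Lambda> = "topspace L"
  have bil: "bilinear B" using assms(1) by (simp add: compatible_duality_def)
  have cover: "convex_lagrangian_cover B L \<phi> M"
    and icx: "implicitly_convex ?\<Lambda> (\<lambda>l x. cover_fun B \<phi> l x y)"
    and icy: "implicitly_convex ?\<Lambda> (\<lambda>l y. cover_fun B \<phi> l x y)" for x y
    using assms(3) by (simp_all add: BIC_cover_def)
  have \<Gamma>: "\<phi> l \<in> Gamma_class" if "l \<in> ?\<Lambda>" for l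
    using cover that by (simp add: convex_lagrangian_cover_def)
  have L: "compact_space L" "?\<Lambda> \<noteq> {}"
    and lscy: "lsc_on_topology (prod_topology L euclidean) (\<lambda>(l, y). cover_fun B \<phi> l x y)"
    and lscx: "lsc_on_topology (prod_topology L euclidean) (\<lambda>(l, x). cover_fun B \<phi> l x y)"
    and M: "M = (\<Union>l \<in> ?\<Lambda>. lagrangian_graph B (\<phi> l))" for x y
    using cover by (simp_all add: convex_lagrangian_cover_def)
  have b: "b x y = (INF l \<in> ?\<Lambda>. cover_fun B \<phi> l x y)" for x y
    by (simp add: assms(4) cover_fun_def)
  have att: "\<exists>l \<in> ?\<Lambda>. cover_fun B \<phi> l x y = (INF l \<in> ?\<Lambda>. cover_fun B \<phi> l x y)" for x y
    using lsc_on_compact_attains_INF[OF L lsc_on_topology_slice[OF lscx, of x y]] by simp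
  have b_le: "b x y \<le> \<phi> l x + polar_fun B (\<phi> l) y" if "l \<in> ?\<Lambda>" for l x y
    unfolding assms(4) using that by (rule INF_lower)
  have b_ge: "ereal (B x y) \<le> b x y" for x y
    unfolding assms(4) by (intro INF_greatest Fenchel_Young \<Gamma>)
  then have b_ninf: "b x y \<noteq> - \<infinity>" for x y
    by (metis ereal_infty_less_eq(2) PInfty_neq_ereal(1) MInfty_neq_ereal(2))
  \<comment> \<open>A minimising index; neither summand is \<open>- \<infinity>\<close>, so a finite
    sum makes both finite.\<close>
  have sel: "\<exists>l r s. l \<in> ?\<Lambda> \<and> \<phi> l x = ereal r \<and> polar_fun B (\<phi> l) y = ereal s \<and> b x y = ereal (r + s)"
    if "b x y < \<infinity>" for x y
  proof -
    obtain l where l: "l \<in> ?\<Lambda>" "b x y = \<phi> l x + polar_fun B (\<phi> l) y"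
      using att[of x y] by (auto simp: b cover_fun_def)
    then show ?thesis
      using that \<Gamma>[OF l(1)] polar_fun_neq_MInf[OF \<Gamma>[OF l(1)], of B y]
      by (cases "\<phi> l x"; cases "polar_fun B (\<phi> l) y") (auto simp: Gamma_class_def)
  qed
  have graph: "b x y = ereal (B x y) \<longleftrightarrow> (x, y) \<in> M" for x y
  proof
    assume "b x y = ereal (B x y)"
    then show "(x, y) \<in> M" using att[of x y] by (auto simp: M b lagrangian_graph_def cover_fun_def)
  next
    assume "(x, y) \<in> M"
    then show "b x y = ereal (B x y)"
      using b_le[of _ x y] b_ge[of x y] by (force simp: M lagrangian_graph_def)
  qed
  have subx: "y \<in> subdifferential B (\<lambda>z. b z y) x \<longleftrightarrow> b x y = ereal (B x y)" for x y
  proof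
    assume y: "y \<in> subdifferential B (\<lambda>z. b z y) x"
    then have "b x y < \<infinity>" by (auto simp: subdifferential_def split: if_splits)
    then obtain l r s where l: "l \<in> ?\<Lambda>" "\<phi> l x = ereal r" "polar_fun B (\<phi> l) y = ereal s"
      "b x y = ereal (r + s)" using sel by blast
    \<comment> \<open>\<open>b\<close> lies below \<open>\<phi> l + s\<close> along the slice at
      \<open>y\<close> and agrees with it at \<open>x\<close>, so the subgradient inequality passes
      to \<open>\<phi> l\<close>. Taking the supremum over \<open>z\<close> yields
      \<open>s \<le> B x y - r\<close>, the reverse of Fenchel-Young.\<close>
    have "ereal (B z y) - \<phi> l z \<le> ereal (B x y - r)" for z
    proof -
      have "ereal (B z y - B x y) \<le> b z y - ereal (r + s)"
        using y l(4) by (auto simp: subdifferential_def bilinear_lsub[OF bil] split: if_splits)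
      also have "\<dots> \<le> \<phi> l z + ereal s - ereal (r + s)"
        using b_le[OF l(1), of z y] l(3) by (intro ereal_minus_mono) auto
      finally show ?thesis
        using \<Gamma>[OF l(1)] by (cases "\<phi> l z") (auto simp: Gamma_class_def)
    qed
    then have "polar_fun B (\<phi> l) y \<le> ereal (B x y - r)"
      unfolding polar_fun_def by (rule SUP_least)
    then show "b x y = ereal (B x y)" using b_ge[of x y] l by auto
  next
    assume eq: "b x y = ereal (B x y)"
    \<comment> \<open>The linear function \<open>B z y\<close> of \<open>z\<close> minorises the
      slice of \<open>b\<close> and touches it at \<open>x\<close>.\<close>
    have "ereal (B (z - x) y) \<le> b z y - b x y" for z
      using b_ge[of z y] eq by (cases "b z y") (auto simp: bilinear_lsub[OF bil])
    then show "y \<in> subdifferential B (\<lambda>z. b z y) x" using eq by (simp add: subdifferential_def)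
  qed
  have suby: "x \<in> subdifferential (\<lambda>v u. B u v) (\<lambda>v. b x v) y \<longleftrightarrow> b x y = ereal (B x y)" for x y
  proof
    assume x: "x \<in> subdifferential (\<lambda>v u. B u v) (\<lambda>v. b x v) y"
    then have "b x y < \<infinity>" by (auto simp: subdifferential_def split: if_splits)
    then obtain l r s where l: "l \<in> ?\<Lambda>" "\<phi> l x = ereal r" "polar_fun B (\<phi> l) y = ereal s"
      "b x y = ereal (r + s)" using sel by blast
    have "r \<le> B x y - s"
    \<comment> \<open>The supremum defining the biconjugate at \<open>x\<close> may fail to be
      attained, so \<open>r\<close> is approached by \<open>c < r\<close>. For each
      \<open>c\<close>, testing the subgradient inequality at the corresponding \<open>v\<close>
      cancels \<open>B x v\<close> and \<open>r\<close>.\<close>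
    proof (rule dense_le)
      fix c assume "c < r"
      then obtain v where v: "polar_fun B (\<phi> l) v \<le> ereal (B x v - c)"
        using Fenchel_Moreau_at[OF assms(1) \<Gamma>[OF l(1)] l(2)] by blast
      have "ereal (B x v - B x y) \<le> b x v - ereal (r + s)"
        using x l(4) by (auto simp: subdifferential_def bilinear_rsub[OF bil] split: if_splits)
      also have "\<dots> \<le> ereal r + polar_fun B (\<phi> l) v - ereal (r + s)"
        using b_le[OF l(1), of x v] l(2) by (intro ereal_minus_mono) auto
      also have "\<dots> \<le> ereal r + ereal (B x v - c) - ereal (r + s)"
        using v by (intro ereal_minus_mono add_mono) auto
      finally show "c \<le> B x y - s" by simp
    qed
    then show "b x y = ereal (B x y)" using b_ge[of x y] l by auto
  next
    assume eq: "b x y = ereal (B x y)"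
    have "ereal (B x (v - y)) \<le> b x v - b x y" for v
      using b_ge[of x v] eq by (cases "b x v") (auto simp: bilinear_rsub[OF bil])
    then show "x \<in> subdifferential (\<lambda>v u. B u v) (\<lambda>v. b x v) y" using eq by (simp add: subdifferential_def)
  qed
  have "convex_ereal (\<lambda>x. b x y) \<and> lsc_on_topology euclidean (\<lambda>x. b x y)" for y
    unfolding b
    using convex_ereal_INF_if_implicitly_convex[OF icx att] lsc_on_topology_INF_compact[OF L lscx] by blast
  moreover have "convex_ereal (\<lambda>y. b x y) \<and> lsc_on_topology euclidean (\<lambda>y. b x y)" for x
    unfolding b
    using convex_ereal_INF_if_implicitly_convex[OF icy att] lsc_on_topology_INF_compact[OF L lscy] by blast
  ultimately have "bipotential B b"
    unfolding bipotential_def using b_ninf b_ge subx suby by simp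
  moreover have "M = bipotential_graph B b"
    using graph by (auto simp: bipotential_graph_def)
  ultimately show ?thesis by blast
qed

end
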